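(* Fix $p>\frac12$. Every algorithm with conditional sampling access to an unknown distribution $\mu$ over $\{1,\ldots,N\}$ which, for every such $\mu$, given an element $x$ drawn from $\mu$, outputs with probability at least $p$ an estimate of $\mu(x)$ in $[(1-\frac19)\mu(x),(1+\frac19)\mu(x)]$, must draw $\Omega(\log\log N)$ conditional samples.
   Context: Conditional sampling access to $\mu$: an oracle which, given a set $A\subseteq\{1,\ldots,N\}$, returns an element of $A$ distributed according to $\mu$ conditioned on belonging to $A$, independently of past calls. *)

theory Defs
  imports "HOL-Probability.Probability"
begin

text \<open>
  A randomised adaptive algorithm is a decision tree. \<open>Output v\<close> halts with estimate \<open>v\<close>;
  \<open>Random D\<close> draws the remaining computation from \<open>D\<close> using internal randomness (a run that
  halts has flipped finitely many coins, so distributions of countable support suffice);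
  \<open>Cond_Sample A k\<close> queries the oracle with \<open>A\<close> and continues with \<open>k\<close> on the reply.
\<close>

datatype algorithm =
    Output real
  | Random "algorithm pmf"
  | Cond_Sample "nat set" "nat option \<Rightarrow> algorithm"

text \<open>
  Conditioning on \<open>A\<close> is meaningless if \<open>\<mu>\<close> gives \<open>A\<close> mass zero; the oracle then replies \<open>None\<close>.
  Under any convention in which the reply to such a query does not depend on \<open>\<mu>\<close>
  (a uniform element of \<open>A\<close>, say), an algorithm can be simulated from this oracle, so the choice
  made here is the most favourable one to the algorithm.
\<close>

definition cond_oracle :: "nat pmf \<Rightarrow> nat set \<Rightarrow> nat option pmf" where
  "cond_oracle \<mu> A =
     (if set_pmf \<mu> \<inter> A = {} then return_pmf None else map_pmf Some (cond_pmf \<mu> A))"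

text \<open>Joint distribution of the output and the number of conditional samples drawn.\<close>

primrec run :: "nat pmf \<Rightarrow> algorithm \<Rightarrow> (real \<times> nat) pmf" where
  "run \<mu> (Output v) = return_pmf (v, 0)"
| "run \<mu> (Random D) = join_pmf (map_pmf (run \<mu>) D)"
| "run \<mu> (Cond_Sample A k) =
     bind_pmf (cond_oracle \<mu> A) (\<lambda>r. map_pmf (\<lambda>(v, n). (v, Suc n)) (run \<mu> (k r)))"

text \<open>Only replies that the oracle can give to \<open>A\<close> are constrained in the last rule.\<close>

inductive queries_within :: "nat set \<Rightarrow> algorithm \<Rightarrow> bool" for U where
  "queries_within U (Output v)"
| "(\<And>a. a \<in> set_pmf D \<Longrightarrow> queries_within U a) \<Longrightarrow> queries_within U (Random D)"
| "A \<subseteq> U \<Longrightarrow> (\<And>r. r \<in> insert None (Some ` A) \<Longrightarrow> queries_within U (k r)) \<Longrightarrow>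
     queries_within U (Cond_Sample A k)"

text \<open>
  The probability is taken jointly over the input \<open>x\<close> drawn from \<open>\<mu>\<close>, the replies of the oracle and
  the internal randomness of the algorithm.
\<close>

definition estimates_mass :: "real \<Rightarrow> real \<Rightarrow> nat \<Rightarrow> (nat \<Rightarrow> algorithm) \<Rightarrow> bool" where
  "estimates_mass \<epsilon> p N alg \<longleftrightarrow>
     (\<forall>\<mu>. set_pmf \<mu> \<subseteq> {1..N} \<longrightarrow>
        measure_pmf.prob (bind_pmf \<mu> (\<lambda>x. map_pmf (\<lambda>(v, n). (x, v)) (run \<mu> (alg x))))
          {(x, v). v \<in> {(1 - \<epsilon>) * pmf \<mu> x .. (1 + \<epsilon>) * pmf \<mu> x}} \<ge> p)"

text \<open>Worst case over the unknown distribution, the input and the run.\<close>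

definition draws_at_most :: "nat \<Rightarrow> nat \<Rightarrow> (nat \<Rightarrow> algorithm) \<Rightarrow> bool" where
  "draws_at_most q N alg \<longleftrightarrow>
     (\<forall>\<mu>. set_pmf \<mu> \<subseteq> {1..N} \<longrightarrow>
        (\<forall>x\<in>set_pmf \<mu>. \<forall>(v, n)\<in>set_pmf (run \<mu> (alg x)). n \<le> q))"

end

theory Submission
  imports Defs
begin

text \<open>
  Let \<open>\<mu>\<close> be uniform on a random set \<open>S\<close> of \<open>m\<close> elements of \<open>{1..N}\<close>, where \<open>m\<close> ranges over a sequence
  of \<open>2 ^ (q + 4)\<close> sizes growing by factors \<open>Q\<^sup>2\<close>, with \<open>Q = 64 * (q + 1)\<^sup>2\<close>. Consider a query \<open>A\<close> after the
  set \<open>T\<close> of elements has been seen, and put \<open>B = A - T\<close>. If \<open>card B * m / N \<le> 1 / Q\<close>, then \<open>S\<close> most likely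
  misses \<open>B\<close> and the reply is uniform on \<open>A \<inter> T\<close>; if \<open>card B * m / N \<ge> Q\<close>, then the reply is nearly
  uniform on \<open>B\<close>. Apart from this one bit, the reply does not depend on \<open>m\<close>, and at most one size is
  critical, that is, lies between the two cases. With \<open>q\<close> queries there are thus at most \<open>2 ^ q\<close>
  outputs and fewer than \<open>2 ^ q\<close> critical sizes, so that all but \<open>2 ^ (q + 1)\<close> of the sizes lead to
  a wrong estimate, since the intervals of correct estimates are disjoint.

  The probability of a fixed sequence of replies is \<open>E[\<Prod>i. 1 / card (S \<inter> A\<^sub>i)]\<close>, restricted to the \<open>S\<close> that
  contain the replies. Only a lower bound on it is needed, and convexity gives one in terms of the
  expected cardinalities.
\<close>

section \<open>Mixtures, conditioned uniform distributions and a convexity bound\<close>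

lemma measure_bind_pmf:
  "measure_pmf.prob (bind_pmf M f) X = measure_pmf.expectation M (\<lambda>x. measure_pmf.prob (f x) X)"
proof -
  have "emeasure (measure_pmf (bind_pmf M f)) X = \<integral>\<^sup>+x. ennreal (measure_pmf.prob (f x) X) \<partial>measure_pmf M"
    by (simp add: measure_pmf.emeasure_eq_measure[symmetric])
  also have "\<dots> = ennreal (measure_pmf.expectation M (\<lambda>x. measure_pmf.prob (f x) X))"
    by (intro nn_integral_eq_integral measure_pmf.integrable_const_bound[where B=1]) auto
  finally show ?thesis
    by (simp add: measure_pmf.emeasure_eq_measure ennreal_inj integral_nonneg_AE)
qed

lemma cond_pmf_of_set:
  assumes "finite S" "S \<inter> A \<noteq> {}"
  shows "cond_pmf (pmf_of_set S) A = pmf_of_set (S \<inter> A)"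
proof -
  have S: "S \<noteq> {}" using assms by auto
  have card: "card (S \<inter> A) > 0" using assms by (simp add: card_gt_0_iff)
  show ?thesis
  proof (rule pmf_eqI)
    fix i
    show "pmf (cond_pmf (pmf_of_set S) A) i = pmf (pmf_of_set (S \<inter> A)) i"
      using assms S card
      by (subst pmf_cond) (auto simp: measure_pmf_of_set indicator_def divide_simps)
  qed
qed

lemma cond_oracle_of_set:
  assumes "finite S" "S \<noteq> {}"
  shows "cond_oracle (pmf_of_set S) A =
    (if S \<inter> A = {} then return_pmf None else map_pmf Some (pmf_of_set (S \<inter> A)))"
  using assms by (simp add: cond_oracle_def cond_pmf_of_set)

text \<open>The tangent plane at \<open>g\<close> of a convex function of \<open>f\<close>: multiply
  the bounds \<open>g x / f x \<ge> exp (1 - f x / g x)\<close>, which come from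
  \<open>1 + t \<le> exp t\<close>, and apply the latter once more to the exponential. The result is
  affine in \<open>f\<close>, so it can be averaged over a random \<open>f\<close>.\<close>

lemma prod_list_inverse_ge:
  fixes f g :: "'a \<Rightarrow> real"
  assumes "\<And>x. x \<in> set xs \<Longrightarrow> f x > 0" "\<And>x. x \<in> set xs \<Longrightarrow> g x > 0"
  shows "(\<Prod>x\<leftarrow>xs. 1 / f x) \<ge> (\<Prod>x\<leftarrow>xs. 1 / g x) * (1 + (\<Sum>x\<leftarrow>xs. 1 - f x / g x))"
proof -
  have pos: "(\<Prod>x\<leftarrow>xs. 1 / g x) > 0"
    using assms(2) by (induction xs) auto
  have "(\<Prod>x\<leftarrow>xs. 1 / f x) \<ge> (\<Prod>x\<leftarrow>xs. 1 / g x) * exp (\<Sum>x\<leftarrow>xs. 1 - f x / g x)"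
    using assms
  proof (induction xs)
    case (Cons a xs)
    have a: "f a > 0" "g a > 0" using Cons.prems by auto
    have "exp (1 - f a / g a) * (f a / g a) \<le> exp (1 - f a / g a) * exp (f a / g a - 1)"
      using exp_ge_add_one_self[of "f a / g a - 1"] by (intro mult_left_mono) auto
    also have "\<dots> = 1" by (simp flip: exp_add)
    finally have *: "1 / g a * exp (1 - f a / g a) \<le> 1 / f a"
      using a by (simp add: field_simps)
    have "(1 / g a * exp (1 - f a / g a)) * ((\<Prod>x\<leftarrow>xs. 1 / g x) * exp (\<Sum>x\<leftarrow>xs. 1 - f x / g x))
       \<le> 1 / f a * (\<Prod>x\<leftarrow>xs. 1 / f x)"
    proof (intro mult_mono *)
      show "0 \<le> (\<Prod>x\<leftarrow>xs. 1 / g x) * exp (\<Sum>x\<leftarrow>xs. 1 - f x / g x)"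
        using Cons.prems by (intro mult_nonneg_nonneg prod_list_nonneg) (auto intro: less_imp_le)
    qed (use Cons a in \<open>auto intro: less_imp_le\<close>)
    then show ?case by (simp add: exp_add mult_ac)
  qed auto
  moreover have "1 + (\<Sum>x\<leftarrow>xs. 1 - f x / g x) \<le> exp (\<Sum>x\<leftarrow>xs. 1 - f x / g x)"
    by (rule exp_ge_add_one_self)
  ultimately show ?thesis
    using pos by (meson mult_le_cancel_left_pos order_trans)
qed

lemma card_le_1_if_no_less:
  fixes X :: "nat set"
  assumes "\<And>m m'. m \<in> X \<Longrightarrow> m' \<in> X \<Longrightarrow> m < m' \<Longrightarrow> False"
  shows "card X \<le> 1"
  using assms by (cases "finite X") (auto simp: card_le_Suc0_iff_eq, metis linorder_neqE_nat)

section \<open>Counting supports of a given size\<close>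

text \<open>The possible supports of \<open>\<mu>\<close> once \<open>T\<close> has been seen and \<open>Z\<close> is assumed to be missed.\<close>

definition supports :: "nat \<Rightarrow> nat \<Rightarrow> nat set \<Rightarrow> nat set \<Rightarrow> nat set set" where
  "supports N m T Z = {S. S \<subseteq> {1..N} \<and> card S = m \<and> T \<subseteq> S \<and> S \<inter> Z = {}}"

lemma finite_supports [simp]: "finite (supports N m T Z)"
  by (rule finite_subset[of _ "Pow {1..N}"]) (auto simp: supports_def)

text \<open>Removing \<open>T\<close> from a support leaves an arbitrary set of
  \<open>m - card T\<close> elements of \<open>{1..N} - T - Z\<close>.\<close>

lemma card_supports:
  assumes "T \<subseteq> {1..N}" "Z \<subseteq> {1..N}" "T \<inter> Z = {}" "card T \<le> m"
  shows "card (supports N m T Z) = (N - card T - card Z) choose (m - card T)"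
proof -
  have fin: "finite T" "finite Z" using assms finite_subset by blast+
  have "bij_betw (\<lambda>S. S \<union> T) {S. S \<subseteq> {1..N} - T - Z \<and> card S = m - card T} (supports N m T Z)"
  proof (rule bij_betwI[where g = "\<lambda>S. S - T"])
    show "(\<lambda>S. S \<union> T) \<in> {S. S \<subseteq> {1..N} - T - Z \<and> card S = m - card T} \<rightarrow> supports N m T Z"
    proof
      fix S assume "S \<in> {S. S \<subseteq> {1..N} - T - Z \<and> card S = m - card T}"
      then have S: "S \<subseteq> {1..N} - T - Z" "card S = m - card T" by auto
      moreover have "finite S" using S(1) by (rule finite_subset) auto
      ultimately have "card (S \<union> T) = m"
        using fin assms(4) by (subst card_Un_disjoint) auto
      with S assms show "S \<union> T \<in> supports N m T Z" by (auto simp: supports_def)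
    qed
    show "(\<lambda>S. S - T) \<in> supports N m T Z \<rightarrow> {S. S \<subseteq> {1..N} - T - Z \<and> card S = m - card T}"
      using fin by (auto simp: supports_def card_Diff_subset)
  qed (auto simp: supports_def)
  then have "card (supports N m T Z) = card {S. S \<subseteq> {1..N} - T - Z \<and> card S = m - card T}"
    by (simp add: bij_betw_same_card)
  also have "\<dots> = card ({1..N} - T - Z) choose (m - card T)"
    by (rule n_subsets) simp
  also have "card ({1..N} - T - Z) = N - card T - card Z"
  proof -
    have "card ({1..N} - T - Z) = card ({1..N} - T) - card Z"
      using fin assms by (intro card_Diff_subset) auto
    then show ?thesis using fin assms by (simp add: card_Diff_subset)
  qed
  finally show ?thesis .
qed

text \<open>Absorption identity for binomial coefficients: a fixed \<open>r\<close> lies in a random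
  support with probability \<open>(m - card T) / (N - card T - card Z)\<close>.\<close>

lemma card_supports_insert:
  assumes "T \<subseteq> {1..N}" "Z \<subseteq> {1..N}" "T \<inter> Z = {}" "card T < m" "r \<in> {1..N} - T - Z"
  shows "(N - card T - card Z) * card (supports N m (insert r T) Z) =
    (m - card T) * card (supports N m T Z)"
proof -
  have fin: "finite T" "finite Z" using assms finite_subset by blast+
  have "card (T \<union> Z \<union> {r}) \<le> card {1..N}"
    using assms by (intro card_mono) auto
  moreover have "card (T \<union> Z \<union> {r}) = card T + card Z + 1"
    using assms fin by (subst card_Un_disjoint) (auto simp: card_Un_disjoint)
  ultimately have n: "N - card T - card Z = Suc (N - card (insert r T) - card Z)"
    using assms fin by simp
  have j: "m - card T = Suc (m - card (insert r T))"
    using assms fin by simp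
  have "card (supports N m (insert r T) Z) = (N - card (insert r T) - card Z) choose (m - card (insert r T))"
    using assms fin by (intro card_supports) auto
  moreover have "card (supports N m T Z) = (N - card T - card Z) choose (m - card T)"
    using assms by (intro card_supports) auto
  ultimately show ?thesis
    unfolding n j by (simp only: Suc_times_binomial)
qed

section \<open>Weights of reply sequences and reachable states\<close>

text \<open>For a support \<open>S\<close> that contains the replies, this is the probability that
  uniform draws from the sets \<open>S \<inter> A\<close> give one prescribed list of replies; it
  does not depend on the list.\<close>

definition weight :: "nat set list \<Rightarrow> nat set \<Rightarrow> real" where
  "weight As S = (\<Prod>A\<leftarrow>As. 1 / real (card (S \<inter> A)))"

lemma weight_Cons: "weight (A # As) S = 1 / real (card (S \<inter> A)) * weight As S"
  by (simp add: weight_def)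

lemma weight_nonneg [simp]: "weight As S \<ge> 0"
  by (auto simp: weight_def intro!: prod_list_nonneg)

text \<open>The square in \<open>Q\<close> pays for \<open>q + 1\<close> relative errors of order
  \<open>(q + 1) / Q\<close>, whose sum is then a small constant.\<close>

locale sampling_bound =
  fixes q N Q :: nat
  assumes Q_def: "Q = 64 * (q + 1)^2"
begin

text \<open>
  States with \<open>s\<close> queries left, where \<open>As\<close> lists the queries that were answered by a new element (the
  input \<open>x\<close> counts as the reply to \<open>{1..N}\<close>) and \<open>Z\<close> collects the unseen parts of the other queries.
\<close>

definition reachable :: "nat \<Rightarrow> nat set \<Rightarrow> nat set \<Rightarrow> nat set list \<Rightarrow> nat \<Rightarrow> bool" where
  "reachable m T Z As s \<longleftrightarrow>
     T \<subseteq> {1..N} \<and> Z \<subseteq> {1..N} \<and> T \<inter> Z = {} \<and> T \<noteq> {} \<and> Q \<le> m \<and> 2 * m \<le> N \<and>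
     card T + s \<le> q + 1 \<and> length As + s \<le> q + 1 \<and> card Z * m * Q + s * N \<le> q * N \<and>
     (\<forall>A\<in>set As. A \<subseteq> {1..N} \<and> A \<inter> T \<noteq> {} \<and> Q * N \<le> card A * m)"

lemma Q_ge: "Q > 0" "q + 1 < Q" "2 * q \<le> Q"
proof -
  have "64 * (q + 1) \<le> Q" by (simp add: Q_def power2_eq_square)
  moreover have "q + 1 < 64 * (q + 1)" "2 * q \<le> 64 * (q + 1)" by simp_all
  ultimately show "q + 1 < Q" "2 * q \<le> Q" "Q > 0" by auto
qed

context
  fixes m T Z As s
  assumes R: "reachable m T Z As s"
begin

text \<open>\<open>T\<close> is small because
  \<open>card T \<le> q + 1 < Q \<le> m \<le> N / 2\<close>; \<open>Z\<close> is small because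
  \<open>card Z * m * Q \<le> q * N\<close> and \<open>2 * q \<le> Q\<close>.\<close>

lemma reachable_bounds:
  "card T \<le> q + 1" "card T < m" "card T \<ge> 1" "N > 0" "m > 0" "2 * card Z * m \<le> N" 
  "card T + card Z < N" "finite T" "finite Z"
proof -
  have fin: "finite T" "finite Z" using R unfolding reachable_def by (meson finite_atLeastAtMost finite_subset)+
  show "finite T" "finite Z" by fact+
  show *: "card T \<le> q + 1" using R by (auto simp: reachable_def)
  have "Q \<le> m" using R by (simp add: reachable_def)
  then show m: "card T < m" using * Q_ge by linarith
  show m0: "m > 0" using m by simp
  show N: "N > 0" using m R unfolding reachable_def by linarith
  show "card T \<ge> 1" using fin R by (simp add: reachable_def Suc_le_eq card_gt_0_iff)
  have "card Z * m * Q \<le> q * N" using R unfolding reachable_def by linarith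
  then have "card Z * m * Q * 2 \<le> 2 * q * N" by simp
  also have "\<dots> \<le> Q * N" using Q_ge(3) by (intro mult_right_mono) auto
  finally have "(2 * card Z * m) * Q \<le> N * Q" by (simp add: mult_ac)
  then show Z: "2 * card Z * m \<le> N" using Q_ge(1) by simp
  have "2 * card Z * 1 \<le> 2 * card Z * m" using m0 by (intro mult_left_mono) auto
  with Z have "2 * card Z \<le> N" by linarith
  moreover have "2 * card T < N" using m R unfolding reachable_def by linarith
  ultimately show "card T + card Z < N" by linarith
qed

text \<open>For \<open>r\<close> outside \<open>Z\<close>, the exact probability
  \<open>(m - card T) / (N - card T - card Z)\<close> is at most \<open>m / N\<close> once
  \<open>m * (card T + card Z) \<le> card T * N\<close>. Here \<open>card T \<ge> 1\<close> matters:
  seen elements offset the exclusion of \<open>Z\<close>, as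
  \<open>2 * card Z * m \<le> N \<le> card T * N\<close>.\<close>

lemma card_supports_insert_le:
  assumes "r \<in> {1..N} - T"
  shows "card (supports N m (insert r T) Z) * N \<le> card (supports N m T Z) * m"
proof (cases "r \<in> Z")
  case True
  then have "supports N m (insert r T) Z = {}" by (auto simp: supports_def)
  then show ?thesis by simp
next
  case False
  note b = reachable_bounds
  define n where "n = N - card T - card Z"
  define j where "j = m - card T"
  have eq: "n * card (supports N m (insert r T) Z) = j * card (supports N m T Z)"
    unfolding n_def j_def using R b assms False
    by (intro card_supports_insert) (auto simp: reachable_def)
  have "2 * card T * m \<le> card T * N" using R by (simp add: reachable_def)
  moreover have "N \<le> card T * N" using b by simp
  ultimately have "2 * card T * m + 2 * card Z * m \<le> 2 * (card T * N)" using b(6) by linarith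
  then have "m * (card T + card Z) \<le> card T * N" by (simp add: algebra_simps)
  moreover have N: "N = n + (card T + card Z)" "m = j + card T" using b by (auto simp: n_def j_def)
  then have "m * N = m * n + m * (card T + card Z)" "m * N = j * N + card T * N"
    by (metis distrib_left, metis distrib_right)
  ultimately have "j * N \<le> m * n" by linarith
  then have "card (supports N m T Z) * (j * N) \<le> card (supports N m T Z) * (m * n)"
    by (rule mult_left_mono) simp
  with eq have "(card (supports N m (insert r T) Z) * N) * n \<le> (card (supports N m T Z) * m) * n"
    by (simp add: mult_ac)
  moreover have "n > 0" using b by (simp add: n_def)
  ultimately show ?thesis by simp
qed

lemma card_supports_insert_ge:
  assumes "r \<in> {1..N} - T - Z"
  shows "(m - card T) * card (supports N m T Z) \<le> N * card (supports N m (insert r T) Z)"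
proof -
  have "(m - card T) * card (supports N m T Z) = (N - card T - card Z) * card (supports N m (insert r T) Z)"
    using R reachable_bounds assms
    by (intro card_supports_insert[symmetric]) (auto simp: reachable_def)
  also have "\<dots> \<le> N * card (supports N m (insert r T) Z)"
    by (intro mult_right_mono) auto
  finally show ?thesis .
qed

lemma card_supports_insert_le_real:
  assumes "r \<in> {1..N} - T"
  shows "real (card (supports N m (insert r T) Z)) \<le> card (supports N m T Z) * (m / N)"
  using card_supports_insert_le[OF assms] reachable_bounds(4)
  by (simp add: field_simps flip: of_nat_mult)

text \<open>Union bound over \<open>B\<close>, each of whose elements lies in at most a fraction
  \<open>m / N\<close> of the supports.\<close>

lemma card_supports_exclude:
  assumes "B \<subseteq> {1..N}" "B \<inter> T = {}"
  shows "real (card (supports N m T (Z \<union> B))) \<ge> card (supports N m T Z) * (1 - card B * m / N)"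
proof -
  have finB: "finite B" using assms finite_subset by blast
  have "supports N m T Z \<subseteq> supports N m T (Z \<union> B) \<union> (\<Union>r\<in>B. supports N m (insert r T) Z)"
    by (auto simp: supports_def)
  then have "card (supports N m T Z) \<le> card (supports N m T (Z \<union> B) \<union> (\<Union>r\<in>B. supports N m (insert r T) Z))"
    using finB by (intro card_mono) auto
  also have "\<dots> \<le> card (supports N m T (Z \<union> B)) + (\<Sum>r\<in>B. card (supports N m (insert r T) Z))"
    using finB by (intro order_trans[OF card_Un_le] add_left_mono card_UN_le)
  finally have "real (card (supports N m T Z)) \<le>
      card (supports N m T (Z \<union> B)) + (\<Sum>r\<in>B. real (card (supports N m (insert r T) Z)))"
    by (metis of_nat_add of_nat_le_iff of_nat_sum)
  also have "(\<Sum>r\<in>B. real (card (supports N m (insert r T) Z))) \<le> (\<Sum>r\<in>B. card (supports N m T Z) * (m / N))"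
    using assms by (intro sum_mono card_supports_insert_le_real) auto
  finally show ?thesis by (simp add: algebra_simps)
qed

text \<open>Double counting: elements of \<open>T\<close> lie in every support, all others in at
  most a fraction \<open>m / N\<close> of them.\<close>

lemma sum_card_supports_le:
  assumes A: "A \<subseteq> {1..N}"
  shows "(\<Sum>S\<in>supports N m T Z. real (card (S \<inter> A))) \<le> card (supports N m T Z) * (card T + card A * m / N)"
proof -
  have finA: "finite A" using A finite_subset by blast
  have "(\<Sum>S\<in>supports N m T Z. real (card (S \<inter> A))) = (\<Sum>S\<in>supports N m T Z. \<Sum>r | r \<in> A \<and> r \<in> S. 1)"
    by (intro sum.cong) (auto simp: Int_def conj_commute)
  also have "\<dots> = (\<Sum>r\<in>A. \<Sum>S | S \<in> supports N m T Z \<and> r \<in> S. 1)"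
    using finA by (intro sum.swap_restrict) auto
  also have "\<dots> = (\<Sum>r\<in>A. real (card (supports N m (insert r T) Z)))"
    by (intro sum.cong) (auto simp: supports_def intro: arg_cong[where f=card])
  also have "\<dots> = (\<Sum>r\<in>A \<inter> T. real (card (supports N m (insert r T) Z)))
      + (\<Sum>r\<in>A - T. real (card (supports N m (insert r T) Z)))"
    using finA by (subst sum.Int_Diff[of _ _ T]) auto
  also have "\<dots> \<le> (\<Sum>r\<in>A \<inter> T. real (card (supports N m T Z))) + (\<Sum>r\<in>A - T. card (supports N m T Z) * (m / N))"
    using A by (intro add_mono sum_mono card_supports_insert_le_real) (auto simp: insert_absorb)
  also have "\<dots> \<le> card T * card (supports N m T Z) + card A * (card (supports N m T Z) * (m / N))"
    using finA reachable_bounds(8)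
    by (simp only: sum_constant, intro add_mono mult_right_mono) (auto intro!: card_mono mult_right_mono)
  finally show ?thesis by (simp add: algebra_simps)
qed

text \<open>Averages \<open>prod_list_inverse_ge\<close> over the supports, with the tangent taken
  at \<open>c A = card A * m / N\<close>. Each query costs a relative error of at most
  \<open>card T / c A \<le> (q + 1) / Q\<close>, and at most \<open>q + 1\<close> queries together
  cost \<open>1 / 64\<close>.\<close>

lemma sum_weight_ge:
  "(\<Sum>S\<in>supports N m T Z. weight As S) \<ge>
     card (supports N m T Z) * (\<Prod>A\<leftarrow>As. N / (m * card A)) * (1 - 1 / 64)"
proof -
  note b = reachable_bounds
  define c where "c A = card A * m / real N" for A :: "nat set"
  have A: "A \<subseteq> {1..N}" "A \<inter> T \<noteq> {}" "real Q \<le> c A" "c A > 0" if "A \<in> set As" for A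
  proof -
    show *: "A \<subseteq> {1..N}" "A \<inter> T \<noteq> {}" using that R by (auto simp: reachable_def)
    have "Q * N \<le> card A * m" using that R by (auto simp: reachable_def)
    then show "real Q \<le> c A" using b(4) by (simp add: c_def field_simps flip: of_nat_mult)
    with Q_ge(1) show "c A > 0" by linarith
  qed
  have prod_eq: "(\<Prod>A\<leftarrow>As. N / (m * card A)) = (\<Prod>A\<leftarrow>As. 1 / c A)"
    by (simp add: c_def mult_ac)
  have prod_nonneg: "(\<Prod>A\<leftarrow>As. 1 / c A) \<ge> 0"
    using A by (intro prod_list_nonneg) (auto intro: less_imp_le)
  have S: "weight As S \<ge> (\<Prod>A\<leftarrow>As. 1 / c A) * (1 + (\<Sum>A\<leftarrow>As. 1 - card (S \<inter> A) / c A))"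
    if "S \<in> supports N m T Z" for S
    unfolding weight_def
  proof (rule prod_list_inverse_ge)
    fix A assume "A \<in> set As"
    then have "S \<inter> A \<noteq> {}" using A(2) that by (fastforce simp: supports_def)
    moreover have "finite S" using that by (auto simp: supports_def intro: finite_subset)
    ultimately show "real (card (S \<inter> A)) > 0" by (simp add: card_gt_0_iff)
  qed (use A in auto)
  have len: "real (length As) * ((q + 1) / Q) \<le> 1 / 64"
  proof -
    have "length As \<le> q + 1" using R by (simp add: reachable_def)
    then have "real (length As) * ((q + 1) / Q) \<le> real (q + 1) * ((q + 1) / Q)"
      by (intro mult_right_mono) auto
    also have "\<dots> = real (q + 1) * (real (q + 1) / (64 * (real (q + 1) * real (q + 1))))"
      by (simp add: Q_def power2_eq_square algebra_simps)
    also have "\<dots> = 1 / 64"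
      by (simp add: divide_simps del: of_nat_add)
    finally show ?thesis .
  qed
  define F where "F = supports N m T Z"
  have each: "(\<Sum>S\<in>F. 1 - card (S \<inter> A) / c A) \<ge> - (card F * ((q + 1) / Q))"
    if "A \<in> set As" for A
  proof -
    have "(\<Sum>S\<in>F. real (card (S \<inter> A))) \<le> card F * (card T + c A)"
      using sum_card_supports_le[OF A(1)[OF that]] by (simp add: F_def c_def)
    then have "(\<Sum>S\<in>F. card (S \<inter> A) / c A) \<le> card F * (card T + c A) / c A"
      unfolding sum_divide_distrib[symmetric] using A(4)[OF that] by (intro divide_right_mono) auto
    also have "\<dots> = card F + card F * (card T / c A)" 
      using A(4)[OF that] by (simp add: field_simps)
    also have "card F * (card T / c A) \<le> card F * ((q + 1) / Q)"
      using A(3,4)[OF that] b(1) Q_ge(1) by (intro mult_left_mono frac_le) auto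
    finally show ?thesis by (simp add: sum_subtractf)
  qed
  have "(\<Sum>S\<in>F. \<Sum>A\<leftarrow>As. 1 - card (S \<inter> A) / c A) = (\<Sum>A\<leftarrow>As. \<Sum>S\<in>F. 1 - card (S \<inter> A) / c A)"
    by (induction As) (simp_all add: sum.distrib)
  also have "\<dots> \<ge> (\<Sum>A\<leftarrow>As. - (card F * ((q + 1) / Q)))"
    using each by (intro sum_list_mono) 
  finally have "(\<Sum>S\<in>F. \<Sum>A\<leftarrow>As. 1 - card (S \<inter> A) / c A) \<ge> - (card F * (length As * ((q + 1) / Q)))"
    by (simp add: sum_list_triv mult_ac)
  also have "- (card F * (length As * ((q + 1) / Q))) \<ge> - (card F * (1 / 64))"
    using len by (intro le_imp_neg_le mult_left_mono) auto
  finally have "(\<Sum>S\<in>F. 1 + (\<Sum>A\<leftarrow>As. 1 - card (S \<inter> A) / c A)) \<ge> card F * (1 - 1 / 64)"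
    by (simp add: sum.distrib algebra_simps)
  then have "(\<Prod>A\<leftarrow>As. 1 / c A) * (card F * (1 - 1 / 64))
      \<le> (\<Prod>A\<leftarrow>As. 1 / c A) * (\<Sum>S\<in>F. 1 + (\<Sum>A\<leftarrow>As. 1 - card (S \<inter> A) / c A))"
    using prod_nonneg by (intro mult_left_mono) auto
  also have "\<dots> \<le> (\<Sum>S\<in>F. weight As S)"
    unfolding sum_distrib_left F_def by (intro sum_mono S)
  finally show ?thesis unfolding prod_eq by (simp only: F_def mult_ac)
qed

end
end

section \<open>Failure probability on a fixed support\<close>

text \<open>Overrunning the budget of \<open>s\<close> samples counts as a failure, so that trees of unbounded depth are covered.\<close>

definition failing :: "nat \<Rightarrow> nat \<Rightarrow> (real \<times> nat) set" where
  "failing m s = {(v, n). v \<notin> {(1 - 1 / 9) * (1 / real m) .. (1 + 1 / 9) * (1 / real m)} \<or> s < n}"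

definition failure :: "nat \<Rightarrow> nat \<Rightarrow> algorithm \<Rightarrow> nat set \<Rightarrow> real" where
  "failure m s a S = measure_pmf.prob (run (pmf_of_set S) a) (failing m s)"

lemma failure_nonneg [simp]: "failure m s a S \<ge> 0" and failure_le_1 [simp]: "failure m s a S \<le> 1"
  by (simp_all add: failure_def)

lemma failure_Output:
  "failure m s (Output v) S = of_bool (v \<notin> {(1 - 1 / 9) * (1 / real m) .. (1 + 1 / 9) * (1 / real m)})"
  by (simp add: failure_def failing_def measure_return_pmf)

lemma failure_Random: "failure m s (Random D) S = measure_pmf.expectation D (\<lambda>a. failure m s a S)"
  by (simp add: failure_def measure_bind_pmf flip: bind_eq_join_pmf)

lemma integrable_failure [simp]: "integrable (measure_pmf D) (\<lambda>a. failure m s a S)"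
  by (intro measure_pmf.integrable_const_bound[where B=1]) auto

text \<open>Every run draws at least one sample, which overruns an empty budget.\<close>

lemma failure_Cond_0: "failure m 0 (Cond_Sample A f) S = 1"
proof -
  have "set_pmf (run (pmf_of_set S) (Cond_Sample A f)) \<subseteq> failing m 0"
    by (auto simp: failing_def)
  then show ?thesis
    unfolding failure_def by (subst measure_pmf.prob_eq_1) (auto simp: AE_measure_pmf_iff)
qed

lemma failure_Cond_Suc:
  assumes "finite S" "S \<noteq> {}"
  shows "failure m (Suc s) (Cond_Sample A f) S =
    (if S \<inter> A = {} then failure m s (f None) S
     else (\<Sum>r\<in>S \<inter> A. failure m s (f (Some r)) S) / card (S \<inter> A))"
proof -
  have vimage: "(\<lambda>(v, n). (v, Suc n)) -` failing m (Suc s) = failing m s"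
    by (auto simp: failing_def)
  show ?thesis
    using assms
    by (simp add: failure_def measure_bind_pmf measure_map_pmf vimage cond_oracle_of_set
        integral_pmf_of_set integral_return)
qed

section \<open>Averages over the supports and their estimates\<close>

context sampling_bound
begin

text \<open>A joint rather than a conditional expectation: dividing by the number
  \<open>N choose m\<close> of all supports keeps as a factor the probability of the new replies and
  of missing \<open>Z\<close>, so that contributions of different new replies can be added.\<close>

definition average :: "nat \<Rightarrow> nat set \<Rightarrow> nat set \<Rightarrow> nat set list \<Rightarrow> (nat set \<Rightarrow> real) \<Rightarrow> real" where
  "average m T Z As g = (\<Sum>S\<in>supports N m T Z. weight As S * g S) / (N choose m)"

text \<open>
  The estimate of the probability of a state that results from replacing each \<open>card (S \<inter> A)\<close> by
  \<open>card A * m / N\<close>.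
\<close>

definition mass :: "nat \<Rightarrow> nat set \<Rightarrow> nat set \<Rightarrow> nat set list \<Rightarrow> real" where
  "mass m T Z As = card (supports N m T Z) / (N choose m) * (\<Prod>A\<leftarrow>As. N / (m * card A))"

text \<open>The relative loss charged to one query. The factor 3 comes from three factors
  \<open>1 - (q + 1) / Q\<close> in \<open>card_new_ge\<close>.\<close>

definition loss :: real where "loss = 3 * (q + 1) / Q"

lemma average_nonneg: "(\<And>S. g S \<ge> 0) \<Longrightarrow> average m T Z As g \<ge> 0"
  by (auto simp: average_def intro!: divide_nonneg_nonneg sum_nonneg)

lemma mass_nonneg: "mass m T Z As \<ge> 0"
  by (auto simp: mass_def intro!: mult_nonneg_nonneg divide_nonneg_nonneg prod_list_nonneg)

lemma average_one_ge:
  assumes "reachable m T Z As s"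
  shows "average m T Z As (\<lambda>_. 1) \<ge> mass m T Z As * (63 / 64)"
  using divide_right_mono[OF sum_weight_ge[OF assms], of "real (N choose m)"]
  by (simp add: average_def mass_def)

section \<open>Queries whose unseen part is probably missed\<close>

text \<open>Lowering \<open>s\<close> by one releases an allowance of \<open>N\<close> in the bound
  on \<open>card Z * m * Q\<close>, which is what adding \<open>B\<close> to \<open>Z\<close>
  consumes at most.\<close>

lemma reachable_old:
  assumes R: "reachable m T Z As (Suc s)" and B: "B \<subseteq> {1..N}" "B \<inter> T = {}" "card B * m * Q \<le> N"
  shows "reachable m T (Z \<union> B) As s"
proof -
  have "card (Z \<union> B) * m * Q \<le> (card Z + card B) * m * Q"
    by (intro mult_right_mono card_Un_le) auto
  moreover have "card Z * m * Q + Suc s * N \<le> q * N" using R by (simp add: reachable_def)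
  ultimately have "card (Z \<union> B) * m * Q + s * N \<le> q * N"
    using B(3) by (simp add: algebra_simps)
  then show ?thesis using R B by (auto simp: reachable_def)
qed

lemma mass_old:
  assumes R: "reachable m T Z As (Suc s)" and B: "B \<subseteq> {1..N}" "B \<inter> T = {}" "card B * m * Q \<le> N"
  shows "mass m T (Z \<union> B) As \<ge> mass m T Z As * (1 - 1 / Q)"
proof -
  have "real (card B * m) / N \<le> 1 / Q"
    using B(3) Q_ge(1) reachable_bounds(4)[OF R] by (simp add: field_simps flip: of_nat_mult)
  then have "card (supports N m T Z) * (1 - 1 / Q) \<le> card (supports N m T Z) * (1 - card B * m / N)"
    by (intro mult_left_mono) auto
  also have "\<dots> \<le> card (supports N m T (Z \<union> B))"
    using card_supports_exclude[OF R B(1,2)] by simp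
  finally have "card (supports N m T Z) * (1 - 1 / Q) * ((\<Prod>A\<leftarrow>As. N / (m * card A)) / (N choose m))
      \<le> card (supports N m T (Z \<union> B)) * ((\<Prod>A\<leftarrow>As. N / (m * card A)) / (N choose m))"
    by (intro mult_right_mono divide_nonneg_nonneg prod_list_nonneg) auto
  then show ?thesis by (simp add: mass_def mult_ac)
qed

text \<open>Supports that meet the unseen part are dropped, which only lowers the average. For the
  others \<open>S \<inter> A = T \<inter> A\<close>, so the reply is uniform on a set that does not
  depend on \<open>S\<close>, or is \<open>None\<close>.\<close>

lemma average_old:
  assumes R: "reachable m T Z As (Suc s)"
  shows "average m T Z As (failure m (Suc s) (Cond_Sample A f)) \<ge>
    (if T \<inter> A = {} then average m T (Z \<union> (A \<inter> {1..N} - T)) As (failure m s (f None))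
     else (\<Sum>r\<in>T \<inter> A. average m T (Z \<union> (A \<inter> {1..N} - T)) As (failure m s (f (Some r)))) / card (T \<inter> A))"
    (is "_ \<ge> ?rhs")
proof -
  define F where "F = supports N m T (Z \<union> (A \<inter> {1..N} - T))"
  have sub: "F \<subseteq> supports N m T Z" by (auto simp: F_def supports_def)
  have "(\<Sum>S\<in>F. weight As S * failure m (Suc s) (Cond_Sample A f) S) =
    (\<Sum>S\<in>F. weight As S * (if T \<inter> A = {} then failure m s (f None) S
     else (\<Sum>r\<in>T \<inter> A. failure m s (f (Some r)) S) / card (T \<inter> A)))"
  proof (intro sum.cong arg_cong2[where f="(*)"] refl)
    fix S assume "S \<in> F"
    then have S: "S \<subseteq> {1..N}" "T \<subseteq> S" "S \<inter> (A \<inter> {1..N} - T) = {}"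
      by (auto simp: F_def supports_def)
    then have "S \<inter> A = T \<inter> A" by blast
    moreover have "finite S" using S(1) finite_subset by blast
    moreover have "S \<noteq> {}" using S(2) R by (auto simp: reachable_def)
    ultimately show "failure m (Suc s) (Cond_Sample A f) S = (if T \<inter> A = {} then failure m s (f None) S
        else (\<Sum>r\<in>T \<inter> A. failure m s (f (Some r)) S) / card (T \<inter> A))"
      by (simp add: failure_Cond_Suc)
  qed
  also have "\<dots> / (N choose m) = ?rhs"
  proof (cases "T \<inter> A = {}")
    case False
    have "(\<Sum>S\<in>F. weight As S * ((\<Sum>r\<in>T \<inter> A. failure m s (f (Some r)) S) / card (T \<inter> A)))
      = (\<Sum>r\<in>T \<inter> A. \<Sum>S\<in>F. weight As S * failure m s (f (Some r)) S) / card (T \<inter> A)"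
      by (subst sum.swap) (simp add: sum_distrib_left sum_divide_distrib)
    then show ?thesis using False
      by (simp add: average_def F_def sum_divide_distrib mult.commute)
  qed (simp add: average_def F_def)
  finally have eq: "(\<Sum>S\<in>F. weight As S * failure m (Suc s) (Cond_Sample A f) S) / (N choose m) = ?rhs" .
  have "(\<Sum>S\<in>F. weight As S * failure m (Suc s) (Cond_Sample A f) S) \<le>
     (\<Sum>S\<in>supports N m T Z. weight As S * failure m (Suc s) (Cond_Sample A f) S)"
    using sub by (intro sum_mono2) auto
  from divide_right_mono[OF this, of "real (N choose m)"] show ?thesis
    unfolding eq average_def[of m T Z As "failure m (Suc s) (Cond_Sample A f)"] by simp
qed

section \<open>Queries that are probably answered by a new element\<close>

context
  fixes m T Z As s A B
  assumes R: "reachable m T Z As (Suc s)" and A: "A \<subseteq> {1..N}" and B_def: "B = A - T"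
    and big: "Q * N \<le> card B * m"
begin

lemma card_big: "card B \<le> card A" "card A \<le> card B + (q + 1)" "Q \<le> card B" "finite A"
proof -
  show finA: "finite A" using A finite_subset by blast
  show "card B \<le> card A" using finA by (auto simp: B_def intro: card_mono)
  have "card A \<le> card (B \<union> T)"
    using finA reachable_bounds(8)[OF R] by (intro card_mono) (auto simp: B_def)
  also have "\<dots> \<le> card B + card T" by (rule card_Un_le)
  finally show "card A \<le> card B + (q + 1)" using reachable_bounds(1)[OF R] by linarith
  have "m \<le> N" using R by (auto simp: reachable_def)
  then have "Q * m \<le> Q * N" by (rule mult_left_mono) simp
  with big have "Q * m \<le> card B * m" by linarith
  then show "Q \<le> card B" using reachable_bounds(5)[OF R] by simp
qed

lemma reachable_new:
  assumes r: "r \<in> B - Z"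
  shows "reachable m (insert r T) Z (A # As) s"
proof -
  have "card B * m \<le> card A * m" using card_big(1) by (rule mult_right_mono) simp
  with big have "Q * N \<le> card A * m" by linarith
  moreover have "card (insert r T) \<le> Suc (card T)" by (rule card_insert_le_m1) auto
  then have "card (insert r T) + s \<le> q + 1" using R by (simp add: reachable_def)
  moreover have "length (A # As) + s \<le> q + 1" "card Z * m * Q + s * N \<le> q * N"
    using R by (auto simp: reachable_def)
  moreover have "insert r T \<subseteq> {1..N}" "insert r T \<inter> Z = {}" "A \<inter> insert r T \<noteq> {}"
    using R A r by (auto simp: reachable_def B_def)
  moreover have "\<forall>A'\<in>set As. A' \<subseteq> {1..N} \<and> A' \<inter> insert r T \<noteq> {} \<and> Q * N \<le> card A' * m"
    using R by (fastforce simp: reachable_def)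
  moreover have "Z \<subseteq> {1..N}" "Q \<le> m" "2 * m \<le> N" using R by (simp_all add: reachable_def)
  ultimately show ?thesis using A by (simp add: reachable_def)
qed

text \<open>Adding \<open>r\<close> multiplies the number of supports by at least
  \<open>(m - card T) / N\<close>, and the new query contributes the factor
  \<open>N / (m * card A)\<close>. The product is at least
  \<open>(1 - (q + 1) / Q) / card A\<close>, because \<open>card T \<le> q + 1\<close> and
  \<open>Q \<le> m\<close>.\<close>

lemma mass_new:
  assumes r: "r \<in> B - Z"
  shows "mass m (insert r T) Z (A # As) \<ge> mass m T Z As * (1 - (q + 1) / Q) / card A"
proof -
  note b = reachable_bounds[OF R]
  define P where "P = (\<Prod>A\<leftarrow>As. N / (m * real (card A))) / (N choose m)"
  have "P \<ge> 0" unfolding P_def by (intro divide_nonneg_nonneg prod_list_nonneg) auto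
  have A0: "card A > 0" using card_big Q_ge by linarith
  have "m * (1 - (q + 1) / Q) \<le> real (m - card T)"
  proof -
    have "card T * Q \<le> (q + 1) * m"
      using R b(1) by (intro mult_mono) (auto simp: reachable_def)
    then have "real (card T) \<le> m * ((q + 1) / Q)"
      using Q_ge(1) by (simp add: field_simps flip: of_nat_mult of_nat_add of_nat_Suc)
    then show ?thesis using b(2) by (simp add: of_nat_diff algebra_simps)
  qed
  then have "card (supports N m T Z) * (m * (1 - (q + 1) / Q)) \<le> card (supports N m T Z) * real (m - card T)"
    by (rule mult_left_mono) simp
  also have "\<dots> \<le> N * real (card (supports N m (insert r T) Z))"
    using card_supports_insert_ge[OF R, of r] r A 
    by (simp add: B_def mult.commute subset_iff flip: of_nat_mult)
  finally have "card (supports N m T Z) * (m * (1 - (q + 1) / Q)) * (P / (m * card A)) \<le>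
      N * real (card (supports N m (insert r T) Z)) * (P / (m * card A))"
    using \<open>P \<ge> 0\<close> by (intro mult_right_mono) auto
  then show ?thesis using b(5) by (simp add: mass_def P_def mult_ac)
qed

text \<open>Summing the factor of \<open>mass_new\<close> over all new replies nearly recovers 1:
  \<open>Z\<close> takes little of \<open>B\<close>, and \<open>A\<close> is hardly larger than
  \<open>B\<close>. With \<open>x = (q + 1) / Q\<close>, Bernoulli bounds \<open>(1 - x) ^ 3\<close>
  by \<open>1 - 3 * x\<close>.\<close>

lemma card_new_ge: "card (B - Z) * ((1 - (q + 1) / Q) / card A) \<ge> 1 - loss"
proof -
  note b = reachable_bounds[OF R]
  note c = card_big
  have B0: "card B > 0" "card A > 0" using c Q_ge by linarith+
  have Q: "real Q > 0" using Q_ge by simp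
  define x where "x = (q + 1) / real Q"
  have x: "0 \<le> x" "x \<le> 1" using Q_ge(2) Q by (auto simp: x_def)
  have fin: "finite B" using c(4) by (simp add: B_def)
  \<comment> \<open>Since \<open>card Z \<le> q * N / (m * Q)\<close> and
    \<open>N \<le> card B * m\<close>, at most a fraction \<open>q / Q\<close> of \<open>B\<close>
    is lost to \<open>Z\<close>.\<close>
  have "card Z * m * Q \<le> q * N" using R unfolding reachable_def by linarith
  also have "q * N \<le> q * (Q * N)" using Q_ge(1) by simp
  also have "\<dots> \<le> q * (card B * m)" using big by (intro mult_left_mono) auto
  finally have "(card Z * Q) * m \<le> (q * card B) * m" by (simp add: mult_ac)
  then have "card Z * Q \<le> q * card B" using b(5) by simp
  then have Z: "real (card Z) \<le> card B * (q / Q)"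
    using Q by (simp add: field_simps flip: of_nat_mult)
  also have "\<dots> \<le> card B * x" unfolding x_def by (intro mult_left_mono divide_right_mono) auto
  finally have "real (card B) * (1 - x) \<le> card B - card Z" by (simp add: algebra_simps)
  also have "\<dots> \<le> card (B - Z)"
    using diff_card_le_card_Diff[of Z B] b(9) by linarith
  finally have BZ: "real (card (B - Z)) \<ge> card B * (1 - x)" .
  \<comment> \<open>The at most \<open>q + 1\<close> seen elements of \<open>A\<close> are a
    fraction of at most \<open>x\<close> of \<open>card B\<close>, as \<open>Q \<le> card B\<close>;
    then \<open>(1 + x) * (1 - x) \<le> 1\<close>.\<close>
  have "real (q + 1) * Q \<le> real (q + 1) * card B" using c(3) by (intro mult_left_mono) auto
  then have "real (q + 1) \<le> card B * x"
    unfolding x_def times_divide_eq_right pos_le_divide_eq[OF Q] by (simp only: mult.commute)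
  then have "real (card A) * (1 - x) \<le> (card B + card B * x) * (1 - x)"
    using c(2) x by (intro mult_right_mono) linarith+
  also have "\<dots> = card B * (1 - x * x)" by (simp add: algebra_simps)
  also have "\<dots> \<le> real (card B) * 1" using x by (intro mult_left_mono) auto
  finally have AB: "real (card A) * (1 - x) \<le> card B" by simp
  have "1 - 3 * x \<le> (1 - x) * (1 - x) * (1 - x)"
    using Bernoulli_inequality[of "-x" 3] x by (simp add: power3_eq_cube)
  then have "card A * (1 - 3 * x) \<le> card A * ((1 - x) * (1 - x) * (1 - x))"
    by (intro mult_left_mono) auto
  also have "\<dots> = (card A * (1 - x)) * (1 - x) * (1 - x)" by simp
  also have "\<dots> \<le> card B * (1 - x) * (1 - x)"
    using AB x by (intro mult_right_mono) auto
  also have "\<dots> \<le> card (B - Z) * (1 - x)"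
    using BZ x by (intro mult_right_mono) auto
  finally have "1 - 3 * x \<le> card (B - Z) * (1 - x) / card A"
    using B0 by (simp add: field_simps)
  then show ?thesis by (simp add: x_def loss_def)
qed

end

text \<open>Exchanging the sums over \<open>r\<close> and \<open>S\<close>, each support passes
  \<open>weight As S / card (S \<inter> A)\<close> to each of its replies; replies in
  \<open>T\<close> are dropped. Cutting \<open>A\<close> down to \<open>{1..N}\<close> leaves
  \<open>S \<inter> A\<close> unchanged.\<close>

lemma average_new:
  assumes R: "reachable m T Z As (Suc s)"
  shows "average m T Z As (failure m (Suc s) (Cond_Sample A f)) \<ge>
    (\<Sum>r\<in>A \<inter> {1..N} - T - Z. average m (insert r T) Z ((A \<inter> {1..N}) # As) (failure m s (f (Some r))))"
proof -
  define F where "F = supports N m T Z"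
  define B where "B = A \<inter> {1..N} - T - Z"
  define g where "g r S = weight ((A \<inter> {1..N}) # As) S * failure m s (f (Some r)) S" for r S
  have g: "g r S \<ge> 0" for r S by (simp add: g_def)
  have "(\<Sum>r\<in>B. \<Sum>S\<in>supports N m (insert r T) Z. g r S) = (\<Sum>r\<in>B. \<Sum>S | S \<in> F \<and> r \<in> S. g r S)"
    by (intro sum.cong) (auto simp: supports_def F_def)
  also have "\<dots> = (\<Sum>S\<in>F. \<Sum>r | r \<in> B \<and> r \<in> S. g r S)"
    by (intro sum.swap_restrict[symmetric]) (auto simp: F_def B_def)
  also have "\<dots> \<le> (\<Sum>S\<in>F. weight As S * failure m (Suc s) (Cond_Sample A f) S)"
  proof (intro sum_mono)
    fix S assume "S \<in> F"
    then have S: "S \<subseteq> {1..N}" "T \<subseteq> S" by (auto simp: F_def supports_def)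
    then have "finite S" "S \<noteq> {}" using R finite_subset by (auto simp: reachable_def)
    have SA: "S \<inter> (A \<inter> {1..N}) = S \<inter> A" using S by auto
    have "(\<Sum>r | r \<in> B \<and> r \<in> S. g r S) \<le> (\<Sum>r\<in>S \<inter> A. g r S)"
      using \<open>finite S\<close> g by (intro sum_mono2) (auto simp: B_def)
    also have "\<dots> \<le> weight As S * failure m (Suc s) (Cond_Sample A f) S"
    proof (cases "S \<inter> A = {}")
      case False
      then show ?thesis using \<open>finite S\<close> \<open>S \<noteq> {}\<close> unfolding g_def weight_Cons SA
        by (simp add: failure_Cond_Suc sum_distrib_left sum_divide_distrib mult_ac)
    qed simp
    finally show "(\<Sum>r | r \<in> B \<and> r \<in> S. g r S) \<le> weight As S * failure m (Suc s) (Cond_Sample A f) S" .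
  qed
  finally have "(\<Sum>r\<in>B. \<Sum>S\<in>supports N m (insert r T) Z. g r S) / (N choose m) \<le>
      (\<Sum>S\<in>F. weight As S * failure m (Suc s) (Cond_Sample A f) S) / (N choose m)"
    by (rule divide_right_mono) simp
  then show ?thesis
    by (simp add: average_def sum_divide_distrib g_def F_def B_def)
qed


section \<open>Induction over the decision tree\<close>

lemma loss_bounds: "0 \<le> loss" "loss \<le> 1" "q * loss \<le> 3 / 64"
proof -
  have Q: "real Q = 64 * (real (q + 1) * real (q + 1))"
    by (simp add: Q_def power2_eq_square algebra_simps)
  have loss: "loss = 3 / (64 * real (q + 1))"
  proof -
    have "3 * x / (64 * (x * x)) = 3 / (64 * x)" if "x > 0" for x :: real
      using that by (simp add: divide_simps)
    from this[of "real (q + 1)"] show ?thesis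
      by (simp only: loss_def Q of_nat_mult of_nat_numeral of_nat_0_less_iff zero_less_Suc Suc_eq_plus1[symmetric] simp_thms)
  qed
  show "0 \<le> loss" "loss \<le> 1" "q * loss \<le> 3 / 64"
    by (simp_all add: loss divide_simps)
qed

lemma average_Random:
  "average m T Z As (failure m s (Random D)) =
     measure_pmf.expectation D (\<lambda>a. average m T Z As (failure m s a))"
  by (simp add: average_def failure_Random Bochner_Integration.integral_sum)

text \<open>Brings the bound at outputs and exhausted budgets, where at most one size is lost, into
  the form of the induction. If the last factor is negative, \<open>X \<ge> 0\<close>
  suffices.\<close>

lemma weaken_to_sum_bound:
  assumes "X \<ge> 0" "X \<ge> \<rho> * (63 / 64) * (x - 1)" "\<rho> \<ge> 0"
  shows "X \<ge> \<rho> * (63 / 64 * (1 - loss) ^ s) * (x - (2 ^ (s + 1) - 1))"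
proof (cases "x - (2 ^ (s + 1) - 1) \<ge> 0")
  case True
  have "(2::real) ^ (s + 1) \<ge> 2" by simp
  then have "(1 - loss) ^ s * (x - (2 ^ (s + 1) - 1)) \<le> 1 * (x - 1)"
    using loss_bounds True by (intro mult_mono power_le_one) auto
  then have "\<rho> * (63 / 64) * ((1 - loss) ^ s * (x - (2 ^ (s + 1) - 1))) \<le> \<rho> * (63 / 64) * (x - 1)"
    using assms(3) by (intro mult_left_mono) auto
  with assms(2) have "\<rho> * (63 / 64) * ((1 - loss) ^ s * (x - (2 ^ (s + 1) - 1))) \<le> X" by (rule order_trans[rotated])
  then show ?thesis by (simp only: mult.assoc)
next
  case False
  then have "\<rho> * (63 / 64 * (1 - loss) ^ s) * (x - (2 ^ (s + 1) - 1)) \<le> 0"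
    using assms(3) loss_bounds by (intro mult_nonneg_nonpos) auto
  with assms(1) show ?thesis by linarith
qed

text \<open>The number \<open>2 ^ (s + 1) - 1\<close> counts the sizes given up: one at an output,
  and at a query those of two subproblems plus one critical size. The common bound
  \<open>\<rho>\<close> lets all sizes of a subproblem follow the same branch of the tree, while
  \<open>Ms\<close> shrinks to the sizes that behave alike.\<close>

lemma sum_failure_ge:
  assumes "finite Ms" "\<And>m m'. m \<in> Ms \<Longrightarrow> m' \<in> Ms \<Longrightarrow> m < m' \<Longrightarrow> Q * Q * m \<le> m'"
    and "\<And>m. m \<in> Ms \<Longrightarrow> reachable m T Z As s"
    and "\<And>m. m \<in> Ms \<Longrightarrow> \<rho> \<le> mass m T Z As" "\<rho> \<ge> 0"
  shows "(\<Sum>m\<in>Ms. average m T Z As (failure m s a)) \<ge>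
     \<rho> * (63 / 64 * (1 - loss) ^ s) * (real (card Ms) - (2 ^ (s + 1) - 1))"
  using assms
proof (induction a arbitrary: Ms T Z As s \<rho>)
  case (Output v)
  define bad where "bad = {m \<in> Ms. v \<in> {(1 - 1 / 9) * (1 / real m) .. (1 + 1 / 9) * (1 / real m)}}"
  \<comment> \<open>Of two sizes the larger is at least twice the smaller, since
    \<open>Q * Q \<ge> 2\<close>. The intervals of correct estimates are then disjoint because
    \<open>(1 + 1 / 9) / 2 < 1 - 1 / 9\<close>.\<close>
  have "card bad \<le> 1"
  proof (rule card_le_1_if_no_less)
    fix m m' assume *: "m \<in> bad" "m' \<in> bad" "m < m'"
    then have "Q * Q * m \<le> m'" using Output.prems(2) by (simp add: bad_def)
    moreover have "2 * 1 \<le> Q * Q" using Q_ge(2) by (intro mult_mono) auto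
    then have "2 * m \<le> Q * Q * m" by (intro mult_right_mono) auto
    ultimately have "2 * m \<le> m'" by linarith
    moreover have "m > 0" using *(1) Output.prems(3)[of m] reachable_bounds(5)[of m T Z As s] by (auto simp: bad_def)
    ultimately have "1 / real m' \<le> 1 / (2 * real m)" by (intro divide_left_mono) auto
    also have "\<dots> = 1 / real m / 2" by simp
    finally have "1 / real m' \<le> 1 / real m / 2" .
    moreover have "1 / real m > 0" using \<open>m > 0\<close> by simp
    moreover have "(1 - 1 / 9) * (1 / real m) \<le> (1 + 1 / 9) * (1 / real m')"
      using * by (auto simp: bad_def)
    moreover have False if "y \<le> x / 2" "x > 0" "(1 - 1 / 9) * x \<le> (1 + 1 / 9) * y" for x y :: real
      using that by simp
    ultimately show False by blast
  qed
  then have "\<rho> * (63 / 64) * (real (card Ms) - 1) \<le> \<rho> * (63 / 64) * (real (card Ms) - card bad)"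
    using Output.prems(5) by (intro mult_left_mono) auto
  also have "real (card Ms) - card bad = card (Ms - bad)"
    using Output.prems(1) by (subst card_Diff_subset) (auto simp: bad_def of_nat_diff card_mono)
  also have "\<rho> * (63 / 64) * card (Ms - bad) = (\<Sum>m\<in>Ms - bad. \<rho> * (63 / 64))" by simp
  also have "\<dots> \<le> (\<Sum>m\<in>Ms - bad. average m T Z As (failure m s (Output v)))"
  proof (rule sum_mono)
    fix m assume m: "m \<in> Ms - bad"
    then have "failure m s (Output v) = (\<lambda>_. 1)" by (auto simp: failure_Output bad_def)
    moreover have "\<rho> * (63 / 64) \<le> mass m T Z As * (63 / 64)"
      using m Output.prems(4) by (intro mult_right_mono) auto
    ultimately show "\<rho> * (63 / 64) \<le> average m T Z As (failure m s (Output v))"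
      using average_one_ge[OF Output.prems(3), of m] m by auto
  qed
  also have "\<dots> \<le> (\<Sum>m\<in>Ms. average m T Z As (failure m s (Output v)))"
    using Output.prems(1) by (intro sum_mono2 average_nonneg) auto
  finally show ?case
    using Output.prems(5) by (intro weaken_to_sum_bound sum_nonneg average_nonneg) auto
next
  case (Random D)
  have "\<rho> * (63 / 64 * (1 - loss) ^ s) * (real (card Ms) - (2 ^ (s + 1) - 1)) \<le>
     measure_pmf.expectation D (\<lambda>a. \<Sum>m\<in>Ms. average m T Z As (failure m s a))"
  proof (rule measure_pmf.integral_ge_const)
    show "AE a in D. \<rho> * (63 / 64 * (1 - loss) ^ s) * (real (card Ms) - (2 ^ (s + 1) - 1)) \<le>
       (\<Sum>m\<in>Ms. average m T Z As (failure m s a))"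
      unfolding AE_measure_pmf_iff by (intro ballI Random.IH Random.prems)
  qed (simp add: average_def)
  also have "\<dots> = (\<Sum>m\<in>Ms. average m T Z As (failure m s (Random D)))"
    unfolding average_Random by (rule Bochner_Integration.integral_sum) (simp add: average_def)
  finally show ?case .
next
  case (Cond_Sample A f)
  note IH = Cond_Sample.IH[OF rangeI]
  note prems = Cond_Sample.prems
  show ?case
  proof (cases s)
    case 0
    have "\<rho> * (63 / 64) * (real (card Ms) - 1) \<le> \<rho> * (63 / 64) * card Ms"
      using prems(5) by (intro mult_left_mono) auto
    also have "\<dots> = (\<Sum>m\<in>Ms. \<rho> * (63 / 64))" by simp
    also have "\<dots> \<le> (\<Sum>m\<in>Ms. average m T Z As (failure m s (Cond_Sample A f)))"
    proof (rule sum_mono)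
      fix m assume m: "m \<in> Ms"
      have "failure m s (Cond_Sample A f) = (\<lambda>_. 1)" using 0 by (auto simp: failure_Cond_0)
      moreover have "\<rho> * (63 / 64) \<le> mass m T Z As * (63 / 64)"
        using m prems(4) by (intro mult_right_mono) auto
      ultimately show "\<rho> * (63 / 64) \<le> average m T Z As (failure m s (Cond_Sample A f))"
        using average_one_ge[OF prems(3)[OF m]] by auto
    qed
    finally show ?thesis
      using prems(5) by (intro weaken_to_sum_bound sum_nonneg average_nonneg) auto
  next
    case s: (Suc s')
    define B where "B = A \<inter> {1..N} - T"
    define c where "c = 63 / 64 * (1 - loss) ^ s'"
    define d :: real where "d = 2 ^ (s' + 1) - 1"
    have c0: "c \<ge> 0" using loss_bounds by (simp add: c_def)
    define D where "D K = (\<Sum>m\<in>K. average m T Z As (failure m s (Cond_Sample A f)))" for K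
    define old where "old = {m\<in>Ms. card B * m * Q \<le> N}"
    define new where "new = {m\<in>Ms. Q * N \<le> card B * m}"
    define critical where "critical = {m\<in>Ms. N < card B * m * Q \<and> card B * m < Q * N}"
    have D0: "D K \<ge> 0" for K unfolding D_def by (intro sum_nonneg average_nonneg) simp
    \<comment> \<open>The critical range of \<open>card B * m\<close> is the open interval from
      \<open>N / Q\<close> to \<open>Q * N\<close>, and the next size, larger by a factor
      \<open>Q * Q\<close>, jumps over it.\<close>
    have "card critical \<le> 1"
    proof (rule card_le_1_if_no_less)
      fix m m' assume *: "m \<in> critical" "m' \<in> critical" "m < m'"
      have "Q * N \<le> Q * (card B * m * Q)" using * by (intro mult_left_mono) (auto simp: critical_def)
      also have "\<dots> = card B * (Q * Q * m)" by simp
      also have "\<dots> \<le> card B * m'" using * prems(2) by (intro mult_left_mono) (auto simp: critical_def)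
      finally show False using * by (auto simp: critical_def)
    qed
    moreover have "Ms \<subseteq> old \<union> (new \<union> critical)" by (auto simp: old_def new_def critical_def)
    then have "card Ms \<le> card (old \<union> (new \<union> critical))"
      using prems(1) by (intro card_mono) (auto simp: old_def new_def critical_def)
    moreover have "\<dots> \<le> card old + (card new + card critical)"
      by (intro order_trans[OF card_Un_le] add_left_mono card_Un_le)
    ultimately have card_Ms: "card Ms \<le> card old + card new + 1" by linarith
    have mass0: "mass m T Z As \<ge> 0" for m by (rule mass_nonneg)
    have old: "D old \<ge> \<rho> * (c * (1 - loss)) * (card old - d)"
    proof (cases "real (card old) - d \<ge> 0")
      case True
      \<comment> \<open>An old reply costs only \<open>1 / Q\<close>; charging \<open>loss\<close>
        gives both subproblems the same factor.\<close>
      have inv: "1 / Q \<le> loss" unfolding loss_def using Q_ge by (intro divide_right_mono) auto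
      have old_IH: "(\<Sum>m\<in>old. average m T (Z \<union> B) As (failure m s' (f r))) \<ge> \<rho> * (1 - loss) * c * (card old - d)" for r
        unfolding c_def d_def
      proof (rule IH)
        fix m assume "m \<in> old"
        then have m: "m \<in> Ms" "reachable m T Z As (Suc s')" "card B * m * Q \<le> N"
          using prems(3) s by (auto simp: old_def)
        have B: "B \<subseteq> {1..N}" "B \<inter> T = {}" by (auto simp: B_def)
        show "reachable m T (Z \<union> B) As s'" by (rule reachable_old[OF m(2) B m(3)])
        have "\<rho> * (1 - loss) \<le> mass m T Z As * (1 - 1 / Q)"
          using prems(4)[OF m(1)] inv prems(5) loss_bounds mass0 by (intro mult_mono) auto
        also have "\<dots> \<le> mass m T (Z \<union> B) As" by (rule mass_old[OF m(2) B m(3)])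
        finally show "\<rho> * (1 - loss) \<le> mass m T (Z \<union> B) As" .
      qed (use prems loss_bounds in \<open>auto simp: old_def\<close>)
      have "D old \<ge> (\<Sum>m\<in>old. if T \<inter> A = {} then average m T (Z \<union> B) As (failure m s' (f None))
         else (\<Sum>r\<in>T \<inter> A. average m T (Z \<union> B) As (failure m s' (f (Some r)))) / card (T \<inter> A))" (is "_ \<ge> ?x")
        unfolding D_def s B_def
        by (intro sum_mono average_old) (use prems(3) s in \<open>auto simp: old_def\<close>)
      moreover have "?x \<ge> \<rho> * (1 - loss) * c * (card old - d)"
      proof (cases "T \<inter> A = {} \<or> old = {}")
        case True
        with old_IH[of None] show ?thesis by auto
      next
        case False
        then obtain m where "reachable m T Z As s" using prems(3) by (auto simp: old_def)
        then have "finite T" by (rule reachable_bounds)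
        then have card: "card (T \<inter> A) > 0" using False by (simp add: card_gt_0_iff)
        have "card (T \<inter> A) * (\<rho> * (1 - loss) * c * (card old - d)) =
            (\<Sum>r\<in>T \<inter> A. \<rho> * (1 - loss) * c * (card old - d))" by simp
        also have "\<dots> \<le> (\<Sum>r\<in>T \<inter> A. \<Sum>m\<in>old. average m T (Z \<union> B) As (failure m s' (f (Some r))))"
          by (intro sum_mono old_IH)
        also have "\<dots> = (\<Sum>m\<in>old. \<Sum>r\<in>T \<inter> A. average m T (Z \<union> B) As (failure m s' (f (Some r))))"
          by (rule sum.swap)
        finally show ?thesis using card False
          by (simp add: pos_le_divide_eq mult.commute flip: sum_divide_distrib)
      qed
      ultimately show ?thesis by (simp add: mult_ac)
    next
      case False
      then have "\<rho> * (c * (1 - loss)) * (card old - d) \<le> 0"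
        using prems(5) c0 loss_bounds by (intro mult_nonneg_nonpos) auto
      with D0[of old] show ?thesis by linarith
    qed
    have new: "D new \<ge> \<rho> * (c * (1 - loss)) * (card new - d)"
    \<comment> \<open>Any member of \<open>new\<close> supplies the hypotheses of
      \<open>card_new_ge\<close>, whose conclusion does not mention the size; the sign permits
      multiplying that inequality by \<open>card new - d\<close>.\<close>
    proof (cases "real (card new) - d \<ge> 0 \<and> new \<noteq> {}")
      case True
      then obtain m0 where "m0 \<in> new" by auto
      then have m0: "reachable m0 T Z As (Suc s')" "Q * N \<le> card B * m0"
        using prems(3) s by (auto simp: new_def)
      define A' where "A' = A \<inter> {1..N}"
      have A': "A' \<subseteq> {1..N}" "B = A' - T" by (auto simp: A'_def B_def)
      have Q: "1 - (q + 1) / real Q \<ge> 0" using Q_ge by simp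
      have new_IH: "(\<Sum>m\<in>new. average m (insert r T) Z (A' # As) (failure m s' (f (Some r)))) \<ge>
         \<rho> * (1 - (q + 1) / Q) / card A' * c * (card new - d)" if r: "r \<in> B - Z" for r
        unfolding c_def d_def
      proof (rule IH)
        fix m assume "m \<in> new"
        then have m: "m \<in> Ms" "reachable m T Z As (Suc s')" "Q * N \<le> card B * m"
          using prems(3) s by (auto simp: new_def)
        show "reachable m (insert r T) Z (A' # As) s'" by (rule reachable_new[OF m(2) A' m(3) r])
        have "\<rho> * (1 - (q + 1) / Q) / card A' \<le> mass m T Z As * (1 - (q + 1) / Q) / card A'"
          using prems(4)[OF m(1)] Q by (intro divide_right_mono mult_right_mono) auto
        also have "\<dots> \<le> mass m (insert r T) Z (A' # As)" by (rule mass_new[OF m(2) A' m(3) r])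
        finally show "\<rho> * (1 - (q + 1) / Q) / card A' \<le> mass m (insert r T) Z (A' # As)" .
      qed (use prems Q in \<open>auto simp: new_def\<close>)
      \<comment> \<open>Each reply in \<open>B - Z\<close> carries about \<open>1 / card A'\<close>
        of the mass; adding all of them restores it up to the factor
        \<open>1 - loss\<close>.\<close>
      have "\<rho> * c * (card new - d) * (1 - loss) \<le>
         \<rho> * c * (card new - d) * (card (B - Z) * ((1 - (q + 1) / Q) / card A'))"
        using card_new_ge[OF m0(1) A' m0(2)] prems(5) c0 True by (intro mult_left_mono) auto
      also have "\<dots> = (\<Sum>r\<in>B - Z. \<rho> * (1 - (q + 1) / Q) / card A' * c * (card new - d))"
        by simp
      also have "\<dots> \<le> (\<Sum>r\<in>B - Z. \<Sum>m\<in>new. average m (insert r T) Z (A' # As) (failure m s' (f (Some r))))"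
        by (intro sum_mono new_IH)
      also have "\<dots> = (\<Sum>m\<in>new. \<Sum>r\<in>B - Z. average m (insert r T) Z (A' # As) (failure m s' (f (Some r))))"
        by (rule sum.swap)
      also have "\<dots> \<le> D new"
        unfolding D_def s A'_def B_def
        by (intro sum_mono average_new) (use prems(3) s in \<open>auto simp: new_def\<close>)
      finally show ?thesis by (simp add: mult_ac)
    next
      case False
      have "(1::real) \<le> 2 ^ (s' + 1)" by (rule one_le_power) simp
      then have "d \<ge> 0" by (simp add: d_def)
      then have "\<rho> * (c * (1 - loss)) * (card new - d) \<le> 0"
        using prems(5) c0 loss_bounds False by (intro mult_nonneg_nonpos) auto
      with D0[of new] show ?thesis by linarith
    qed
    have disj: "old \<inter> new = {}"
    proof safe
      fix m assume m: "m \<in> old" "m \<in> new"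
      then have "N > 0" using prems(3)[of m] reachable_bounds(4)[of m T Z As s] by (auto simp: old_def)
      have "Q * (Q * N) \<le> Q * (card B * m)" using m by (intro mult_left_mono) (auto simp: new_def)
      also have "\<dots> \<le> N" using m by (simp add: old_def mult_ac)
      finally have "Q * Q \<le> 1" using \<open>N > 0\<close> by (simp flip: mult.assoc)
      moreover have "1 * 1 < Q * Q" using Q_ge by (intro mult_strict_mono) auto
      ultimately show "m \<in> {}" by simp
    qed
    \<comment> \<open>The recursion \<open>2 * d + 1 = 2 ^ (s + 1) - 1\<close>, the extra 1 being
      the critical size.\<close>
    have "real (card Ms) - (2 ^ (s + 1) - 1) \<le> (card old - d) + (card new - d)"
      using card_Ms by (simp add: d_def s)
    then have "\<rho> * (c * (1 - loss)) * (real (card Ms) - (2 ^ (s + 1) - 1)) \<le>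
      \<rho> * (c * (1 - loss)) * ((card old - d) + (card new - d))"
      using prems(5) c0 loss_bounds by (intro mult_left_mono) auto
    also have "\<dots> \<le> D old + D new" using add_mono[OF old new] by (simp only: distrib_left)
    also have "\<dots> = D (old \<union> new)" unfolding D_def
      using prems(1) disj by (intro sum.union_disjoint[symmetric]) (auto simp: old_def new_def)
    also have "\<dots> \<le> D Ms" unfolding D_def
      using prems(1) by (intro sum_mono2 average_nonneg) (auto simp: old_def new_def)
    finally show ?thesis by (simp add: D_def c_def s mult_ac)
  qed
qed

section \<open>The initial state and the input\<close>

text \<open>The input takes up one element of \<open>T\<close> and one entry of \<open>As\<close>
  while all \<open>q\<close> queries remain, which is why \<open>reachable\<close> allows
  \<open>q + 1\<close> of each.\<close>

lemma reachable_first: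
  assumes "Q \<le> m" "2 * m \<le> N" "x \<in> {1..N}"
  shows "reachable m {x} {} [{1..N}] q"
  using assms by (auto simp: reachable_def)

text \<open>A fraction \<open>m / N\<close> of the supports contains \<open>x\<close>, and the input
  is \<open>x\<close> with probability \<open>1 / m\<close>. The product is free of \<open>m\<close>
  and serves as the initial \<open>\<rho>\<close>.\<close>

lemma mass_first:
  assumes "Q \<le> m" "2 * m \<le> N" "x \<in> {1..N}"
  shows "mass m {x} {} [{1..N}] = 1 / N"
proof -
  have m: "m > 0" "N > 0" using assms Q_ge by auto
  have "N * card (supports N m {x} {}) = m * card (supports N m {} {})"
    using card_supports_insert[of "{}" N "{}" m x] assms m by simp
  also have "card (supports N m {} {}) = N choose m" by (subst card_supports) auto
  finally have "real N * card (supports N m {x} {}) = m * real (N choose m)"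
    by (simp flip: of_nat_mult)
  moreover have "N choose m > 0" using assms by simp
  ultimately show ?thesis using m by (simp add: mass_def field_simps)
qed

text \<open>Exchanging the sums turns the joint averages over inputs into a uniform support followed
  by a uniform input from it.\<close>

lemma sum_average_first:
  assumes "m > 0"
  shows "(\<Sum>x\<in>{1..N}. average m {x} {} [{1..N}] (g x)) =
    (\<Sum>S\<in>supports N m {} {}. (\<Sum>x\<in>S. g x S) / m) / (N choose m)"
proof -
  have "(\<Sum>x\<in>{1..N}. \<Sum>S\<in>supports N m {x} {}. weight [{1..N}] S * g x S) =
    (\<Sum>x\<in>{1..N}. \<Sum>S | S \<in> supports N m {} {} \<and> x \<in> S. g x S / m)"
  proof (intro sum.cong)
    fix x S assume "S \<in> {S \<in> supports N m {} {}. x \<in> S}"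
    then have "card S = m" "S \<inter> {1..N} = S" by (auto simp: supports_def)
    then show "weight [{1..N}] S * g x S = g x S / m" unfolding weight_def by simp
  qed (auto simp: supports_def)
  also have "\<dots> = (\<Sum>S\<in>supports N m {} {}. \<Sum>x | x \<in> {1..N} \<and> x \<in> S. g x S / m)"
    by (intro sum.swap_restrict[symmetric]) auto
  also have "\<dots> = (\<Sum>S\<in>supports N m {} {}. (\<Sum>x\<in>S. g x S) / m)"
    by (auto simp: supports_def sum_divide_distrib intro!: sum.cong)
  finally show ?thesis by (simp add: average_def flip: sum_divide_distrib)
qed

text \<open>For \<mu> uniform on \<open>S\<close>, \<open>pmf \<mu> x = 1 / m\<close> on
  \<open>S\<close>, and no run exceeds the budget \<open>q\<close>; hence failure is almost surely
  the complement of a correct estimate.\<close>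

lemma failure_le:
  assumes est: "estimates_mass (1 / 9) p N alg" and draws: "draws_at_most q N alg"
    and S: "S \<subseteq> {1..N}" "card S = m" "m > 0"
  shows "(\<Sum>x\<in>S. failure m q (alg x) S) / m \<le> 1 - p"
proof -
  have fin: "finite S" "S \<noteq> {}" using S by (auto intro: card_ge_0_finite)
  define \<mu> where "\<mu> = pmf_of_set S"
  have set: "set_pmf \<mu> = S" using fin by (simp add: \<mu>_def)
  have "p \<le> measure_pmf.prob (bind_pmf \<mu> (\<lambda>x. map_pmf (\<lambda>(v, n). (x, v)) (run \<mu> (alg x))))
          {(x, v). v \<in> {(1 - 1 / 9) * pmf \<mu> x .. (1 + 1 / 9) * pmf \<mu> x}}" (is "_ \<le> ?prob")
    using est S(1) unfolding estimates_mass_def set[symmetric] by blast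
  also have "?prob = (\<Sum>x\<in>S. measure_pmf.prob (run \<mu> (alg x))
      {(v, n). v \<in> {(1 - 1 / 9) * pmf \<mu> x .. (1 + 1 / 9) * pmf \<mu> x}}) / m"
    unfolding measure_bind_pmf measure_map_pmf using fin S
    by (simp add: \<mu>_def integral_pmf_of_set vimage_def case_prod_unfold)
  also have "(\<Sum>x\<in>S. measure_pmf.prob (run \<mu> (alg x))
      {(v, n). v \<in> {(1 - 1 / 9) * pmf \<mu> x .. (1 + 1 / 9) * pmf \<mu> x}}) =
      (\<Sum>x\<in>S. 1 - failure m q (alg x) S)"
  proof (rule sum.cong)
    fix x assume x: "x \<in> S"
    then have pmf: "pmf \<mu> x = 1 / m" using fin S by (simp add: \<mu>_def)
    have "1 - failure m q (alg x) S = measure_pmf.prob (run \<mu> (alg x)) (UNIV - failing m q)"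
      using measure_pmf.prob_compl[of "failing m q" "run \<mu> (alg x)"] by (simp add: failure_def \<mu>_def)
    also have "\<dots> = measure_pmf.prob (run \<mu> (alg x))
      {(v, n). v \<in> {(1 - 1 / 9) * pmf \<mu> x .. (1 + 1 / 9) * pmf \<mu> x}}"
    proof (rule measure_pmf.finite_measure_eq_AE)
      have "\<forall>(v, n)\<in>set_pmf (run \<mu> (alg x)). n \<le> q"
        using draws S(1) x unfolding draws_at_most_def set[symmetric] by blast
      then show "AE y in run \<mu> (alg x). (y \<in> UNIV - failing m q) =
        (y \<in> {(v, n). v \<in> {(1 - 1 / 9) * pmf \<mu> x .. (1 + 1 / 9) * pmf \<mu> x}})"
        unfolding AE_measure_pmf_iff pmf failing_def by fastforce
    qed auto
    finally show "measure_pmf.prob (run \<mu> (alg x))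
      {(v, n). v \<in> {(1 - 1 / 9) * pmf \<mu> x .. (1 + 1 / 9) * pmf \<mu> x}} = 1 - failure m q (alg x) S" by simp
  qed simp
  finally show ?thesis using S by (simp add: sum_subtractf field_simps)
qed

section \<open>From failing sizes to the lower bound\<close>

text \<open>The failure probabilities, averaged over supports and inputs and summed over the sizes,
  are at least \<open>t\<close> by the induction and at most \<open>card Ms * (1 - p)\<close> by the
  assumed success.\<close>

lemma success_probability_le:
  assumes est: "estimates_mass (1 / 9) p N alg" and draws: "draws_at_most q N alg"
    and Ms: "finite Ms" "\<And>m m'. m \<in> Ms \<Longrightarrow> m' \<in> Ms \<Longrightarrow> m < m' \<Longrightarrow> Q * Q * m \<le> m'"
      "\<And>m. m \<in> Ms \<Longrightarrow> Q \<le> m \<and> 2 * m \<le> N" "2 ^ (q + 4) \<le> card Ms"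
  shows "p \<le> 1 / 2"
proof -
  have "card Ms > 0" using Ms(4) by (rule less_le_trans[rotated]) simp
  then obtain m0 where "m0 \<in> Ms" by (auto simp: card_gt_0_iff)
  then have N: "N > 0" using Ms(3)[of m0] Q_ge by auto
  define t where "t = 63 / 64 * (1 - loss) ^ q * (real (card Ms) - (2 ^ (q + 1) - 1))"
  have "t = (\<Sum>x\<in>{1..N}. 1 / N * t)" using N by simp
  also have "\<dots> \<le> (\<Sum>x\<in>{1..N}. \<Sum>m\<in>Ms. average m {x} {} [{1..N}] (failure m q (alg x)))"
  proof (rule sum_mono)
    fix x assume x: "x \<in> {1..N}"
    have "1 / N * (63 / 64 * (1 - loss) ^ q) * (real (card Ms) - (2 ^ (q + 1) - 1)) \<le>
        (\<Sum>m\<in>Ms. average m {x} {} [{1..N}] (failure m q (alg x)))"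
    proof (rule sum_failure_ge[OF Ms(1,2)])
      fix m assume "m \<in> Ms"
      then show "reachable m {x} {} [{1..N}] q" "1 / N \<le> mass m {x} {} [{1..N}]"
        using Ms(3)[of m] x by (simp_all only: reachable_first mass_first order_refl)
    qed auto
    then show "1 / N * t \<le> (\<Sum>m\<in>Ms. average m {x} {} [{1..N}] (failure m q (alg x)))"
      by (simp only: t_def mult.assoc)
  qed
  also have "\<dots> = (\<Sum>m\<in>Ms. \<Sum>x\<in>{1..N}. average m {x} {} [{1..N}] (failure m q (alg x)))"
    by (rule sum.swap)
  also have "\<dots> \<le> (\<Sum>m\<in>Ms. 1 - p)"
  proof (rule sum_mono)
    fix m assume m: "m \<in> Ms"
    then have m0: "m > 0" "m \<le> N" using Ms(3)[of m] Q_ge by auto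
    have card: "card (supports N m {} {}) = N choose m" by (subst card_supports) auto
    have "(\<Sum>S\<in>supports N m {} {}. (\<Sum>x\<in>S. failure m q (alg x) S) / m) \<le> (\<Sum>S\<in>supports N m {} {}. 1 - p)"
      using failure_le[OF est draws] m0 by (intro sum_mono) (auto simp: supports_def)
    also have "\<dots> = (1 - p) * (N choose m)" by (simp add: card)
    finally show "(\<Sum>x\<in>{1..N}. average m {x} {} [{1..N}] (failure m q (alg x))) \<le> 1 - p"
      unfolding sum_average_first[OF m0(1)] using m0 by (simp add: field_simps)
  qed
  finally have le: "t \<le> card Ms * (1 - p)" by simp
  \<comment> \<open>The factor \<open>61 / 64\<close> comes from
    \<open>q * loss \<le> 3 / 64\<close> by Bernoulli, and \<open>7 / 8\<close> from
    \<open>2 ^ (q + 1)\<close> being an eighth of \<open>2 ^ (q + 4)\<close>. The product exceeds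
    \<open>1 / 2\<close>.\<close>
  have "(63 / 64 * (61 / 64)) * (7 / 8 * card Ms) \<le> t"
    unfolding t_def
  proof (intro mult_mono)
    have "61 / 64 \<le> 1 + real q * (- loss)" using loss_bounds by simp
    also have "\<dots> \<le> (1 + (- loss)) ^ q" using loss_bounds by (intro Bernoulli_inequality) simp
    finally show "61 / 64 \<le> (1 - loss) ^ q" by simp
    have "real (2 ^ (q + 4)) \<le> card Ms" using Ms(4) by (simp only: of_nat_le_iff)
    then show "7 / 8 * real (card Ms) \<le> real (card Ms) - (2 ^ (q + 1) - 1)"
      by (simp add: power_add)
  qed (use loss_bounds in auto)
  with le have "card Ms * (1 / 2) \<le> card Ms * (1 - p)" by simp
  with \<open>card Ms > 0\<close> show ?thesis by simp
qed

end

lemma domain_size_less: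
  assumes "p > 1 / 2" "estimates_mass (1 / 9) p N alg" "draws_at_most q N alg"
  shows "N < 2 ^ (2 ^ (2 * q + 8))"
proof (rule ccontr)
  assume "\<not> N < 2 ^ (2 ^ (2 * q + 8))"
  then have N: "2 ^ (2 ^ (2 * q + 8)) \<le> N" by simp
  define Q where "Q = 64 * (q + 1)^2"
  interpret sampling_bound q N Q by standard (rule Q_def)
  have Q2: "Q \<ge> 2" using Q_ge by simp
  define K :: nat where "K = 2 ^ (q + 4)"
  \<comment> \<open>Even exponents give the ratio \<open>Q * Q\<close>; starting at
    \<open>k = 1\<close> ensures \<open>Q \<le> m\<close>.\<close>
  define Ms where "Ms = (\<lambda>k. Q ^ (2 * k)) ` {1..K}"
  have "q + 1 \<le> 2 ^ q" by (induction q) auto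
  then have "Q \<le> 64 * (2 ^ q)^2" unfolding Q_def by (intro mult_left_mono power_mono) auto
  also have "\<dots> = 2 ^ (2 * q + 6)" by (simp add: power_add power_mult mult.commute)
  finally have "2 * Q ^ (2 * K) \<le> 2 * (2 ^ (2 * q + 6)) ^ (2 * K)" by (intro mult_left_mono power_mono) auto
  also have "\<dots> = 2 ^ (1 + (2 * q + 6) * (2 * K))" by (simp only: power_mult power_add power_one_right)
  also have "\<dots> \<le> 2 ^ (2 ^ (2 * q + 8))"
  proof (rule power_increasing)
    \<comment> \<open>Raising \<open>2 * q + 6\<close> to \<open>2 * q + 7\<close> leaves a spare
      \<open>2 * K\<close>, which absorbs the leading 1 of the exponent.\<close>
    have "2 * q + 7 \<le> 2 ^ (q + 3)" by (induction q) (auto simp: power_add)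
    then have "(2 * q + 7) * (2 * K) \<le> 2 ^ (q + 3) * (2 * K)" by (rule mult_right_mono) simp
    also have "2 ^ (q + 3) * (2 * K) = 2 ^ ((q + 3) + Suc (q + 4))"
      by (simp only: K_def power_add power_Suc)
    also have "(q + 3) + Suc (q + 4) = 2 * q + 8" by simp
    finally have "(2 * q + 7) * (2 * K) \<le> 2 ^ (2 * q + 8)" .
    moreover have "(2 * q + 7) * (2 * K) = (2 * q + 6) * (2 * K) + 2 * K" by (simp add: algebra_simps)
    moreover have "1 \<le> K" by (simp add: K_def)
    ultimately show "1 + (2 * q + 6) * (2 * K) \<le> 2 ^ (2 * q + 8)" by linarith
  qed simp
  also have "\<dots> \<le> N" by fact
  finally have QN: "2 * Q ^ (2 * K) \<le> N" .
  have "p \<le> 1 / 2"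
  proof (rule success_probability_le[OF assms(2,3)])
    show "finite Ms" by (simp add: Ms_def)
    have "inj (\<lambda>k. Q ^ (2 * k))" using Q2 by (intro injI) (simp add: power_inject_exp)
    then have "card Ms = K" unfolding Ms_def by (subst card_image) (auto intro: inj_on_subset)
    then show "2 ^ (q + 4) \<le> card Ms" by (simp add: K_def)
  next
    fix m m' assume "m \<in> Ms" "m' \<in> Ms" "m < m'"
    then obtain k k' where k: "m = Q ^ (2 * k)" "m' = Q ^ (2 * k')" by (auto simp: Ms_def)
    with \<open>m < m'\<close> have "k < k'" using Q2 by (auto simp: power_strict_increasing_iff)
    then have "Q ^ (2 * k + 2) \<le> Q ^ (2 * k')" using Q2 by (intro power_increasing) auto
    then show "Q * Q * m \<le> m'" by (simp add: k mult_ac)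
  next
    fix m assume "m \<in> Ms"
    then obtain k where k: "m = Q ^ (2 * k)" "1 \<le> k" "k \<le> K" by (auto simp: Ms_def)
    have "Q ^ 1 \<le> Q ^ (2 * k)" "Q ^ (2 * k) \<le> Q ^ (2 * K)" using k Q2 by (intro power_increasing; simp)+
    then show "Q \<le> m \<and> 2 * m \<le> N" using QN k by simp
  qed
  with assms(1) show False by simp
qed

theorem theorem10p22:
  fixes p :: real
  assumes "p > 1 / 2"
  shows "\<exists>c>0. \<forall>\<^sub>F N in sequentially. \<forall>(alg :: nat \<Rightarrow> algorithm) (q :: nat).
           (\<forall>x\<in>{1..N}. queries_within {1..N} (alg x)) \<longrightarrow>
           estimates_mass (1 / 9) p N alg \<longrightarrow>
           draws_at_most q N alg \<longrightarrow>
           c * ln (ln (real N)) \<le> real q"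
\<comment> \<open>With \<open>L = ln (ln N)\<close>, the size bound gives
  \<open>L \<le> 2 * q + 8\<close>; for \<open>L \<ge> 16\<close> this yields
  \<open>q \<ge> (L - 8) / 2 \<ge> L / 4\<close>.\<close>
proof (intro exI[of _ "1 / 4 :: real"] conjI)
  have "filterlim (\<lambda>N. ln (ln (real N))) at_top sequentially"
    by (intro filterlim_compose[OF ln_at_top] filterlim_real_sequentially)
  then have "\<forall>\<^sub>F N in sequentially. ln (ln (real N)) \<ge> 16"
    by (simp add: filterlim_at_top)
  moreover have "\<forall>\<^sub>F N in sequentially. N \<ge> (3::nat)" by (rule eventually_ge_at_top)
  ultimately show "\<forall>\<^sub>F N in sequentially. \<forall>(alg :: nat \<Rightarrow> algorithm) (q :: nat).
           (\<forall>x\<in>{1..N}. queries_within {1..N} (alg x)) \<longrightarrow>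
           estimates_mass (1 / 9) p N alg \<longrightarrow>
           draws_at_most q N alg \<longrightarrow>
           1 / 4 * ln (ln (real N)) \<le> real q"
  proof (eventually_elim, intro allI impI)
    fix N q :: nat and alg
    assume N: "16 \<le> ln (ln (real N))" "3 \<le> N"
      and "estimates_mass (1 / 9) p N alg" "draws_at_most q N alg"
    then have "N < 2 ^ (2 ^ (2 * q + 8))" using assms domain_size_less by blast
    then have "real N \<le> 2 ^ (2 ^ (2 * q + 8))" by (metis less_imp_le of_nat_le_iff of_nat_numeral of_nat_power)
    then have "ln (real N) \<le> ln (2 ^ (2 ^ (2 * q + 8)))" using N(2) by (subst ln_le_cancel_iff) auto
    also have "\<dots> = 2 ^ (2 * q + 8) * ln 2" by (simp add: ln_realpow)
    also have "\<dots> \<le> 2 ^ (2 * q + 8) * 1" using ln_le_minus_one[of "2::real"] by (intro mult_left_mono) auto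
    finally have "ln (real N) \<le> 2 ^ (2 * q + 8)" by simp
    moreover have "ln (real N) > 0" using N(2) by simp
    ultimately have "ln (ln (real N)) \<le> ln (2 ^ (2 * q + 8))" by (subst ln_le_cancel_iff) auto
    also have "\<dots> = (2 * real q + 8) * ln 2" by (simp add: ln_realpow)
    also have "\<dots> \<le> (2 * real q + 8) * 1" using ln_le_minus_one[of "2::real"] by (intro mult_left_mono) auto
    finally show "1 / 4 * ln (ln (real N)) \<le> real q" using N(1) by simp
  qed
qed simp

end
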